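(* Let $H\in(0,\frac12)$, $\lambda>0$, $\sigma\in\mathbb{R}$, and let $X_t=\sigma\int_{-\infty}^te^{-\lambda(t-s)}\,dB^H_s$, $t\ge0$, be the one-dimensional stationary fractional Ornstein-Uhlenbeck process. Then for every $\alpha\in(0,H)$ there exist a constant $0<\beta<1$ and an almost surely finite random variable $C$, independent of $T$, such that, almost surely, $$|X_t-X_s|\le C\,T^{\beta}\,|t-s|^{\alpha}\qquad\text{for all } T>0\text{ and all }0\le s,t\le T.$$
   Context: $B^H=(B^H_s)_{s\in\mathbb{R}}$ is a two-sided one-dimensional fractional Brownian motion with Hurst parameter $H$ (centred continuous Gaussian, $\mathbb{E}|B^H_t-B^H_s|^2=|t-s|^{2H}$, $B^H_0=0$). The integral is a pathwise Riemann-Stieltjes (Young) integral; $X$ has continuous paths and is a stationary Gaussian process. *)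

theory Defs
  imports "HOL-Probability.Probability"
begin

section \<open>Fractional Brownian motion\<close>

text \<open>
  The affine image of the standard normal law with slope 0 is a point mass, so degenerate
  Gaussian variables are included.
\<close>

definition gaussian_rv :: "'a measure \<Rightarrow> ('a \<Rightarrow> real) \<Rightarrow> bool" where
  "gaussian_rv M Y \<longleftrightarrow> Y \<in> borel_measurable M \<and>
     (\<exists>\<mu> \<tau>. distr M borel Y = distr std_normal_distribution borel (\<lambda>x. \<mu> + \<tau> * x))"

definition gaussian_process :: "'a measure \<Rightarrow> ('i \<Rightarrow> 'a \<Rightarrow> real) \<Rightarrow> bool" where
  "gaussian_process M X \<longleftrightarrow>
     (\<forall>J c. finite J \<longrightarrow> gaussian_rv M (\<lambda>\<omega>. \<Sum>i\<in>J. c i * X i \<omega>))"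

text \<open>Continuity of paths and the value at time 0 are only required almost surely.\<close>

locale fractional_brownian_motion = prob_space M
  for M :: "'a measure" and H :: real and B :: "real \<Rightarrow> 'a \<Rightarrow> real" +
  assumes hurst: "0 < H" "H < 1"
    and gaussian: "gaussian_process M B"
    and centred: "\<And>t. expectation (B t) = 0"
    and increments: "\<And>s t. expectation (\<lambda>\<omega>. \<bar>B t \<omega> - B s \<omega>\<bar>\<^sup>2) = \<bar>t - s\<bar> powr (2 * H)"
    and continuous_paths: "AE \<omega> in M. continuous_on UNIV (\<lambda>t. B t \<omega>)"
    and start: "AE \<omega> in M. B 0 \<omega> = 0"

section \<open>Pathwise Riemann-Stieltjes integral\<close>

text \<open>
  The limit is taken as the mesh of the tagged division tends to 0 (not along gauges). The
  members of a division of \<open>{a..b}\<close> are nonempty compact intervals, with end points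
  \<open>Inf K\<close> and \<open>Sup K\<close>.
\<close>

definition has_RS_integral ::
    "(real \<Rightarrow> real) \<Rightarrow> (real \<Rightarrow> real) \<Rightarrow> real \<Rightarrow> real \<Rightarrow> real \<Rightarrow> bool" where
  "has_RS_integral f g a b I \<longleftrightarrow>
     (\<forall>e>0. \<exists>d>0. \<forall>p. p tagged_division_of {a..b} \<and> (\<forall>(x, K)\<in>p. Sup K - Inf K < d) \<longrightarrow>
        \<bar>(\<Sum>(x, K)\<in>p. f x * (g (Sup K) - g (Inf K))) - I\<bar> < e)"

definition RS_integral :: "(real \<Rightarrow> real) \<Rightarrow> (real \<Rightarrow> real) \<Rightarrow> real \<Rightarrow> real \<Rightarrow> real" where
  "RS_integral f g a b = (THE I. has_RS_integral f g a b I)"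

text \<open>The integral over \<open>{..b}\<close> is improper at minus infinity.\<close>

definition RS_integral_atMost :: "(real \<Rightarrow> real) \<Rightarrow> (real \<Rightarrow> real) \<Rightarrow> real \<Rightarrow> real" where
  "RS_integral_atMost f g b = Lim at_bot (\<lambda>a. RS_integral f g a b)"

definition fractional_OU ::
    "real \<Rightarrow> real \<Rightarrow> (real \<Rightarrow> 'a \<Rightarrow> real) \<Rightarrow> real \<Rightarrow> 'a \<Rightarrow> real" where
  "fractional_OU lam \<sigma> B t \<omega> =
     \<sigma> * RS_integral_atMost (\<lambda>s. exp (- lam * (t - s))) (\<lambda>s. B s \<omega>) t"

end

theory Submission
  imports Defs "HOL-Real_Asymp.Real_Asymp"
begin

text \<open>
  The probabilistic content is a weighted form of the Kolmogorov continuity criterion for \<open>B\<close>;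
  everything about the Ornstein-Uhlenbeck process is then a pathwise estimate.

  Fix \<open>\<epsilon> > 0\<close> and \<open>\<gamma> < H\<close>. Since \<open>B\<close> is Gaussian, the moment of order \<open>p\<close> of an increment over a
  dyadic interval of length \<open>2\<^sup>-\<^sup>n\<close> is a constant times \<open>2\<^sup>-\<^sup>n\<^sup>p\<^sup>H\<close>. Divide the increment starting at
  \<open>k / 2\<^sup>n\<close> by \<open>(1 + \<bar>k\<bar> / 2\<^sup>n)\<^sup>\<epsilon> 2\<^sup>-\<^sup>n\<^sup>\<gamma>\<close> and take \<open>p\<close> large: the expectations of the \<open>p\<close>-th powers
  are then summable over all scales \<open>n\<close> and all integers \<open>k\<close>. Hence almost surely one finite random
  variable controls all dyadic increments on the whole line (\<open>dyadic_increments_weighted_bound\<close>).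
  Chaining along dyadic approximations turns this into local \<open>\<gamma>\<close>-Hoelder continuity whose
  constant near \<open>t\<close> grows only like \<open>\<bar>t\<bar>\<^sup>\<epsilon>\<close> (locale \<open>dyadic_hoelder\<close>).

  On a fixed path, integration by parts rewrites the Riemann-Stieltjes integral against the
  exponential kernel as an ordinary integral of increments \<open>B\<^sub>t - B\<^sub>s\<close> (\<open>OU_from_eq_increments\<close>).
  Because the kernel decays exponentially and \<open>B\<^sub>t - B\<^sub>s\<close> grows polynomially in \<open>t - s\<close>, the improper
  integral exists and is of order \<open>\<bar>t\<bar>\<^sup>\<epsilon>\<close>. The cocycle identity for the kernel
  (\<open>OU_from_cocycle\<close>) then transfers the local Hoelder bound from \<open>B\<close> to \<open>X\<close>
  (\<open>OU_integral_regularity\<close>).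

  The exponents are \<open>\<beta> = (H - \<alpha>) / 2\<close>, \<open>\<gamma> = \<alpha> + \<beta>\<close> and \<open>\<epsilon> = \<beta>\<close>. The same \<open>\<beta>\<close> serves two purposes: for
  large \<open>T\<close> it is the growth rate of the Hoelder constant, and for small \<open>T\<close> it is the surplus of
  Hoelder regularity that produces the factor \<open>T\<^sup>\<beta>\<close> (\<open>hoelder_bound_on_all_horizons\<close>).
\<close>

section \<open>Riemann-Stieltjes integrals of smooth functions against continuous ones\<close>

text \<open>Tagged divisions of arbitrarily small mesh exist, by Cousin's lemma for a constant gauge.\<close>

lemma has_RS_integral_unique:
  assumes "a \<le> b" and I: "has_RS_integral f g a b I" and J: "has_RS_integral f g a b J"
  shows "I = J"
proof (rule ccontr)
  assume "I \<noteq> J"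
  define e where "e = \<bar>I - J\<bar> / 2"
  have e: "e > 0" using \<open>I \<noteq> J\<close> by (simp add: e_def)
  obtain d1 where d1: "d1 > 0" and I': "\<And>p. p tagged_division_of {a..b} \<Longrightarrow>
      (\<And>x K. (x, K) \<in> p \<Longrightarrow> Sup K - Inf K < d1) \<Longrightarrow>
      \<bar>(\<Sum>(x, K)\<in>p. f x * (g (Sup K) - g (Inf K))) - I\<bar> < e"
    using I[unfolded has_RS_integral_def, rule_format, OF e] by (metis (mono_tags, lifting) case_prodI2)
  obtain d2 where d2: "d2 > 0" and J': "\<And>p. p tagged_division_of {a..b} \<Longrightarrow>
      (\<And>x K. (x, K) \<in> p \<Longrightarrow> Sup K - Inf K < d2) \<Longrightarrow>
      \<bar>(\<Sum>(x, K)\<in>p. f x * (g (Sup K) - g (Inf K))) - J\<bar> < e"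
    using J[unfolded has_RS_integral_def, rule_format, OF e] by (metis (mono_tags, lifting) case_prodI2)
  define d where "d = min d1 d2"
  have d: "d > 0" using d1 d2 by (simp add: d_def)
  have "gauge (\<lambda>x::real. ball x (d/2))" using d by auto
  then obtain p where p: "p tagged_division_of {a..b}" "(\<lambda>x. ball x (d/2)) fine p"
    using fine_division_exists_real by blast
  have mesh: "Sup K - Inf K < d" if xK: "(x, K) \<in> p" for x K
  proof -
    obtain u v where K: "K = {u..v}" using tagged_division_ofD(4)[OF p(1) xK] by auto
    have "x \<in> K" using tagged_division_ofD(2)[OF p(1) xK] .
    then have uv: "u \<le> v" using K by auto
    have "K \<subseteq> ball x (d/2)" using p(2) xK by (auto simp: fine_def)
    then have "u \<in> ball x (d/2)" "v \<in> ball x (d/2)" using uv K by auto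
    then have "dist u v < d" using dist_triangle_half_r[of x u d v] by simp
    then show ?thesis using uv by (simp add: K dist_real_def)
  qed
  define S where "S = (\<Sum>(x, K)\<in>p. f x * (g (Sup K) - g (Inf K)))"
  have "\<bar>S - I\<bar> < e" unfolding S_def by (rule I'[OF p(1)]) (use mesh in \<open>force simp: d_def\<close>)
  moreover have "\<bar>S - J\<bar> < e" unfolding S_def by (rule J'[OF p(1)]) (use mesh in \<open>force simp: d_def\<close>)
  ultimately show False unfolding e_def by (smt (verit) field_sum_of_halves)
qed

lemma abs_integral_le_const:
  fixes h :: "real \<Rightarrow> real"
  assumes "u \<le> v" "continuous_on {u..v} h" "\<And>r. r \<in> {u..v} \<Longrightarrow> \<bar>h r\<bar> \<le> c"
  shows "\<bar>integral {u..v} h\<bar> \<le> c * (v - u)"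
  using integral_bound[OF assms(1,2)] assms(3) by simp

text \<open>
  All the smoothness is on the side of \<open>f\<close>, so that \<open>g\<close> may be a path of unbounded variation, such as
  one of fractional Brownian motion.
\<close>

lemma has_RS_integral_by_parts:
  fixes f f' g :: "real \<Rightarrow> real"
  assumes "a \<le> b"
    and f: "\<And>x. x \<in> {a..b} \<Longrightarrow> (f has_real_derivative f' x) (at x within {a..b})"
    and f': "continuous_on {a..b} f'" and g: "continuous_on {a..b} g"
  shows "has_RS_integral f g a b (f b * g b - f a * g a - integral {a..b} (\<lambda>x. f' x * g x))"
  unfolding has_RS_integral_def
proof (intro allI impI)
  fix e :: real assume e: "e > 0"
  define F where "F t = f t * g t - integral {a..t} (\<lambda>x. f' x * g x)" for t
  have "bounded (f' ` {a..b})"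
    using f' compact_continuous_image compact_imp_bounded by blast
  then obtain M where M: "M > 0" "\<And>x. x \<in> {a..b} \<Longrightarrow> \<bar>f' x\<bar> \<le> M"
    by (auto simp: bounded_pos)
  define e' where "e' = e / (M * (b - a) + 1)"
  have pos: "M * (b - a) + 1 > 0" using M(1) \<open>a \<le> b\<close> by (simp add: add_nonneg_pos)
  have e': "e' > 0" using e pos by (simp add: e'_def)
  have "uniformly_continuous_on {a..b} g" using g compact_uniformly_continuous by blast
  then obtain d where d: "d > 0"
    and gd: "\<And>x y. x \<in> {a..b} \<Longrightarrow> y \<in> {a..b} \<Longrightarrow> \<bar>x - y\<bar> < d \<Longrightarrow> \<bar>g x - g y\<bar> < e'"
    unfolding uniformly_continuous_on_def dist_real_def using e' by metis
  have cont: "continuous_on {u..v} (\<lambda>r. f' r * (g r - c))" if "{u..v} \<subseteq> {a..b}" for u v c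
    by (intro continuous_intros continuous_on_subset[OF f' that] continuous_on_subset[OF g that])
  have ftc: "((\<lambda>r. f' r) has_integral (f v - f u)) {u..v}" if "{u..v} \<subseteq> {a..b}" "u \<le> v" for u v
    by (rule fundamental_theorem_of_calculus[OF that(2)],
        unfold has_real_derivative_iff_has_vector_derivative[symmetric],
        rule DERIV_subset[OF f that(1)]) (use that in auto)
  \<comment> \<open>The value of the integral is additive in the interval, so it is enough to compare it with a
    single summand of the Riemann sum; there the error is an integral of oscillations of \<open>g\<close>.\<close>
  have loc: "\<bar>f x * (g v - g u) - (F v - F u)\<bar> \<le> M * e' * (v - u)"
    if "a \<le> u" "u \<le> x" "x \<le> v" "v \<le> b" "v - u < d" for u x v
  proof -
    have int: "(\<lambda>r. f' r * g r) integrable_on {s..t}" if "{s..t} \<subseteq> {a..b}" for s t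
      using cont[OF that, of 0] integrable_continuous_interval by auto
    have split: "integral {s..t} (\<lambda>r. f' r * (g r - c)) = integral {s..t} (\<lambda>r. f' r * g r) - c * (f t - f s)"
      if "{s..t} \<subseteq> {a..b}" "s \<le> t" for s t c
    proof -
      have "((\<lambda>r. f' r * g r - c * f' r) has_integral
          (integral {s..t} (\<lambda>r. f' r * g r) - c * (f t - f s))) {s..t}"
        by (intro has_integral_diff has_integral_mult_right integrable_integral int ftc that)
      then show ?thesis
        using integral_unique[of "\<lambda>r. f' r * (g r - c)"] by (simp add: algebra_simps)
    qed
    have comb: "integral {s..t} (\<lambda>r. f' r * g r) = integral {s..y} (\<lambda>r. f' r * g r) + integral {y..t} (\<lambda>r. f' r * g r)"
      if "a \<le> s" "s \<le> y" "y \<le> t" "t \<le> b" for s y t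
      by (rule Henstock_Kurzweil_Integration.integral_combine[symmetric]) (use that int in auto)
    have "f x * (g v - g u) - (F v - F u)
        = integral {u..x} (\<lambda>r. f' r * (g r - g u)) + integral {x..v} (\<lambda>r. f' r * (g r - g v))"
      using that comb[of a u v] comb[of u x v] unfolding F_def
      by (subst (1 2) split) (auto simp: algebra_simps)
    moreover have "\<bar>integral {u..x} (\<lambda>r. f' r * (g r - g u))\<bar> \<le> M * e' * (x - u)"
      using that M gd[THEN less_imp_le] e'
      by (intro abs_integral_le_const cont) (auto simp: abs_mult intro!: mult_mono)
    moreover have "\<bar>integral {x..v} (\<lambda>r. f' r * (g r - g v))\<bar> \<le> M * e' * (v - x)"
      using that M gd[THEN less_imp_le] e'
      by (intro abs_integral_le_const cont) (auto simp: abs_mult intro!: mult_mono)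
    ultimately show ?thesis by (simp add: algebra_simps)
  qed
  have Feq: "F b - F a = f b * g b - f a * g a - integral {a..b} (\<lambda>x. f' x * g x)"
    by (simp add: F_def)
  show "\<exists>d>0. \<forall>p. p tagged_division_of {a..b} \<and> (\<forall>(x, K)\<in>p. Sup K - Inf K < d) \<longrightarrow>
        \<bar>(\<Sum>(x, K)\<in>p. f x * (g (Sup K) - g (Inf K)))
          - (f b * g b - f a * g a - integral {a..b} (\<lambda>x. f' x * g x))\<bar> < e"
  proof (intro exI[of _ d] conjI d allI impI, elim conjE)
    fix p assume p: "p tagged_division_of {a..b}" and mesh: "\<forall>(x, K)\<in>p. Sup K - Inf K < d"
    have sumF: "F b - F a = (\<Sum>(x, K)\<in>p. F (Sup K) - F (Inf K))"
      using additive_tagged_division_1[OF \<open>a \<le> b\<close> p, of F] by simp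
    have sum1: "b - a = (\<Sum>(x, K)\<in>p. Sup K - Inf K)"
      using additive_tagged_division_1[OF \<open>a \<le> b\<close> p, of "\<lambda>x. x"] by simp
    have "\<bar>(\<Sum>(x, K)\<in>p. f x * (g (Sup K) - g (Inf K))) - (F b - F a)\<bar>
        = \<bar>\<Sum>(x, K)\<in>p. f x * (g (Sup K) - g (Inf K)) - (F (Sup K) - F (Inf K))\<bar>"
      unfolding sumF by (simp add: sum_subtractf[symmetric] case_prod_unfold)
    also have "\<dots> \<le> (\<Sum>(x, K)\<in>p. M * e' * (Sup K - Inf K))"
    proof (rule order_trans[OF sum_abs], rule sum_mono, clarify)
      fix x K assume xK: "(x, K) \<in> p"
      obtain u v where K: "K = {u..v}" using tagged_division_ofD(4)[OF p xK] by auto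
      have "x \<in> K" "K \<subseteq> {a..b}" using tagged_division_ofD(2,3)[OF p xK] by auto
      with K have "a \<le> u" "u \<le> x" "x \<le> v" "v \<le> b" by auto
      moreover have "v - u < d" using mesh xK K \<open>u \<le> x\<close> \<open>x \<le> v\<close> by force
      ultimately show "\<bar>f x * (g (Sup K) - g (Inf K)) - (F (Sup K) - F (Inf K))\<bar> \<le> M * e' * (Sup K - Inf K)"
        using loc[of u x v] by (simp add: K)
    qed
    also have "\<dots> = M * e' * (b - a)"
      unfolding sum1 by (simp add: sum_distrib_left case_prod_unfold)
    also have "\<dots> < e"
      using e pos by (simp add: e'_def field_simps)
    finally show "\<bar>(\<Sum>(x, K)\<in>p. f x * (g (Sup K) - g (Inf K)))
          - (f b * g b - f a * g a - integral {a..b} (\<lambda>x. f' x * g x))\<bar> < e"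
      by (simp only: Feq)
  qed
qed

section \<open>Ornstein-Uhlenbeck integrals along a fixed path\<close>

text \<open>The Ornstein-Uhlenbeck integral with unit noise, started from \<open>0\<close> at time \<open>a\<close>.\<close>

definition OU_from :: "real \<Rightarrow> (real \<Rightarrow> real) \<Rightarrow> real \<Rightarrow> real \<Rightarrow> real" where
  "OU_from lam g a t = RS_integral (\<lambda>s. exp (- lam * (t - s))) g a t"

lemma OU_from_eq:
  assumes "a \<le> t" and g: "continuous_on UNIV g"
  shows "OU_from lam g a t = g t - exp (- lam * (t - a)) * g a
      - integral {a..t} (\<lambda>s. lam * exp (- lam * (t - s)) * g s)" (is "_ = ?I")
proof -
  have "has_RS_integral (\<lambda>s. exp (- lam * (t - s))) g a t
      (exp (- lam * (t - t)) * g t - exp (- lam * (t - a)) * g a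
       - integral {a..t} (\<lambda>s. lam * exp (- lam * (t - s)) * g s))"
    by (rule has_RS_integral_by_parts[OF \<open>a \<le> t\<close>])
       (auto intro!: derivative_eq_intros continuous_intros continuous_on_subset[OF g])
  then have "has_RS_integral (\<lambda>s. exp (- lam * (t - s))) g a t ?I" by simp
  then show ?thesis
    unfolding OU_from_def RS_integral_def
    using has_RS_integral_unique[OF \<open>a \<le> t\<close>] by blast
qed

lemma exp_kernel_has_integral:
  assumes "(lam::real) \<noteq> 0" "a \<le> t"
  shows "((\<lambda>s. exp (- lam * (t - s))) has_integral (1 - exp (- lam * (t - a))) / lam) {a..t}"
proof -
  have "((\<lambda>s. exp (- lam * (t - s))) has_integral
      (exp (- lam * (t - t)) / lam - exp (- lam * (t - a)) / lam)) {a..t}"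
    using assms
    by (intro fundamental_theorem_of_calculus)
       (auto simp: has_real_derivative_iff_has_vector_derivative[symmetric]
             intro!: derivative_eq_intros)
  then show ?thesis by (simp add: diff_divide_distrib)
qed

text \<open>
  The kernel and the boundary term have total mass 1, so \<open>g t\<close> can be moved under the integral. Only
  increments of \<open>g\<close> remain, and these are small near \<open>t\<close>, where the kernel is not.
\<close>

lemma OU_from_eq_increments:
  assumes "a \<le> t" and g: "continuous_on UNIV g" and "lam \<noteq> 0"
  shows "OU_from lam g a t = (g t - g a) * exp (- lam * (t - a))
      + integral {a..t} (\<lambda>s. lam * exp (- lam * (t - s)) * (g t - g s))"
proof -
  have int: "(\<lambda>s. lam * exp (- lam * (t - s)) * g s) integrable_on {a..t}"
    by (intro integrable_continuous_interval continuous_intros continuous_on_subset[OF g]) auto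
  have "((\<lambda>s. (lam * g t) * exp (- lam * (t - s)) - lam * exp (- lam * (t - s)) * g s) has_integral
      ((lam * g t) * ((1 - exp (- lam * (t - a))) / lam)
        - integral {a..t} (\<lambda>s. lam * exp (- lam * (t - s)) * g s))) {a..t}"
    by (intro has_integral_diff has_integral_mult_right exp_kernel_has_integral
        integrable_integral int assms)
  moreover have "(\<lambda>s. lam * exp (- lam * (t - s)) * (g t - g s)) =
      (\<lambda>s. (lam * g t) * exp (- lam * (t - s)) - lam * exp (- lam * (t - s)) * g s)"
    by (simp add: fun_eq_iff algebra_simps)
  moreover have "(lam * g t) * ((1 - exp (- lam * (t - a))) / lam) = g t * (1 - exp (- lam * (t - a)))"
    using \<open>lam \<noteq> 0\<close> by simp
  ultimately have "integral {a..t} (\<lambda>s. lam * exp (- lam * (t - s)) * (g t - g s)) =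
      g t * (1 - exp (- lam * (t - a))) - integral {a..t} (\<lambda>s. lam * exp (- lam * (t - s)) * g s)"
    by (simp only: integral_unique)
  then show ?thesis
    unfolding OU_from_eq[OF assms(1,2)] by algebra
qed

text \<open>
  The flow property of the linear equation \<open>dX = - lam X dt + dg\<close>: the state reached at \<open>s\<close> is
  damped exponentially and the noise after \<open>s\<close> is added.
\<close>

lemma OU_from_cocycle:
  assumes "a \<le> s" "s \<le> t" and g: "continuous_on UNIV g"
  shows "OU_from lam g a t = exp (- lam * (t - s)) * OU_from lam g a s + OU_from lam g s t"
proof -
  let ?k = "\<lambda>t r. lam * exp (- lam * (t - r)) * g r"
  have int: "?k t integrable_on {a..t}"
    by (intro integrable_continuous_interval continuous_intros continuous_on_subset[OF g]) auto
  have comb: "integral {a..t} (?k t) = integral {a..s} (?k t) + integral {s..t} (?k t)"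
    by (rule Henstock_Kurzweil_Integration.integral_combine[symmetric]) (use assms int in auto)
  have shift: "exp (- lam * (t - r)) = exp (- lam * (t - s)) * exp (- lam * (s - r))" for r
    by (simp add: exp_add[symmetric] algebra_simps)
  have "?k t = (\<lambda>r. exp (- lam * (t - s)) * ?k s r)"
    by (rule ext, subst shift) simp
  then have "integral {a..s} (?k t) = exp (- lam * (t - s)) * integral {a..s} (?k s)"
    by (simp only: integral_mult_right)
  with comb shift[of a] show ?thesis
    using OU_from_eq[OF order_trans[OF assms(1,2)] g, of lam]
      OU_from_eq[OF \<open>a \<le> s\<close> g, of lam] OU_from_eq[OF \<open>s \<le> t\<close> g, of lam]
    by algebra
qed

lemma polynomial_le_exp:
  assumes "(lam::real) > 0" "x \<ge> 0"
  shows "(2 + x)\<^sup>2 \<le> (2 + 4 / lam)\<^sup>2 * exp (lam * x / 2)"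
proof -
  have "2 + x \<le> (2 + 4 / lam) * (1 + lam * x / 4)"
    using assms by (simp add: field_simps)
  also have "\<dots> \<le> (2 + 4 / lam) * exp (lam * x / 4)"
    using assms exp_ge_add_one_self[of "lam * x / 4"] by (intro mult_left_mono) auto
  finally have "(2 + x)\<^sup>2 \<le> ((2 + 4 / lam) * exp (lam * x / 4))\<^sup>2"
    using assms by (intro power_mono) auto
  also have "\<dots> = (2 + 4 / lam)\<^sup>2 * exp (lam * x / 2)"
    by (simp add: power_mult_distrib exp_of_nat_mult[symmetric] power2_eq_square[of "exp _"] exp_add[symmetric])
  finally show ?thesis .
qed

text \<open>
  The bound is uniform in the starting time \<open>a\<close>: half of the exponential decay absorbs the
  polynomial growth of the increments, and the other half is integrated.
\<close>

lemma OU_from_bound: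
  assumes lam: "lam > 0" and "a \<le> t" and g: "continuous_on UNIV g"
    and growth: "\<And>s. \<bar>g t - g s\<bar> \<le> W * (2 + \<bar>t - s\<bar>)\<^sup>2"
  shows "\<bar>OU_from lam g a t\<bar> \<le> 3 * (2 + 4 / lam)\<^sup>2 * W"
proof -
  define c where "c = (2 + 4 / lam)\<^sup>2 * W"
  have "0 \<le> W * 4" using growth[of t] by simp
  then have W: "W \<ge> 0" by simp
  have c: "c \<ge> 0" using W by (simp add: c_def)
  have ker: "\<bar>g t - g s\<bar> * exp (- lam * (t - s)) \<le> c * exp (- (lam / 2) * (t - s))" if "s \<le> t" for s
  proof -
    have "\<bar>g t - g s\<bar> \<le> W * (2 + (t - s))\<^sup>2" using growth[of s] that by simp
    also have "\<dots> \<le> W * ((2 + 4 / lam)\<^sup>2 * exp (lam * (t - s) / 2))"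
      using W polynomial_le_exp[OF lam, of "t - s"] that by (intro mult_left_mono) auto
    finally have "\<bar>g t - g s\<bar> * exp (- lam * (t - s)) \<le>
        W * ((2 + 4 / lam)\<^sup>2 * exp (lam * (t - s) / 2)) * exp (- lam * (t - s))"
      by (rule mult_right_mono) simp
    also have "\<dots> = c * exp (- (lam / 2) * (t - s))"
      by (simp add: c_def exp_add[symmetric] field_simps)
    finally show ?thesis .
  qed
  have "\<bar>(g t - g a) * exp (- lam * (t - a))\<bar> \<le> c * exp (- (lam / 2) * (t - a))"
    using ker[OF \<open>a \<le> t\<close>] by (simp add: abs_mult)
  also have "\<dots> \<le> c * 1" using c lam \<open>a \<le> t\<close> by (intro mult_left_mono) auto
  finally have 1: "\<bar>(g t - g a) * exp (- lam * (t - a))\<bar> \<le> c" by simp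
  have half: "((\<lambda>s. lam * c * exp (- (lam / 2) * (t - s))) has_integral
      lam * c * ((1 - exp (- (lam / 2) * (t - a))) / (lam / 2))) {a..t}"
    using lam \<open>a \<le> t\<close> by (intro has_integral_mult_right exp_kernel_has_integral) auto
  have "norm (integral {a..t} (\<lambda>s. lam * exp (- lam * (t - s)) * (g t - g s)))
      \<le> integral {a..t} (\<lambda>s. lam * c * exp (- (lam / 2) * (t - s)))"
  proof (rule integral_norm_bound_integral)
    show "(\<lambda>s. lam * exp (- lam * (t - s)) * (g t - g s)) integrable_on {a..t}"
      by (intro integrable_continuous_interval continuous_intros continuous_on_subset[OF g]) auto
    show "(\<lambda>s. lam * c * exp (- (lam / 2) * (t - s))) integrable_on {a..t}"
      using half by blast
    fix s assume "s \<in> {a..t}"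
    then have "lam * (\<bar>g t - g s\<bar> * exp (- lam * (t - s))) \<le> lam * (c * exp (- (lam / 2) * (t - s)))"
      using lam ker[of s] by (intro mult_left_mono) auto
    then show "norm (lam * exp (- lam * (t - s)) * (g t - g s)) \<le> lam * c * exp (- (lam / 2) * (t - s))"
      using lam by (simp add: abs_mult mult_ac)
  qed
  also have "\<dots> = lam * c * ((1 - exp (- (lam / 2) * (t - a))) / (lam / 2))"
    by (rule integral_unique[OF half])
  also have "\<dots> = 2 * c * (1 - exp (- (lam / 2) * (t - a)))"
    using lam by simp
  also have "\<dots> \<le> 2 * c * 1"
    using c by (intro mult_left_mono) auto
  finally have 2: "\<bar>integral {a..t} (\<lambda>s. lam * exp (- lam * (t - s)) * (g t - g s))\<bar> \<le> 2 * c" by simp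
  have "\<bar>OU_from lam g a t\<bar> \<le> c + 2 * c"
    using 1 2 lam unfolding OU_from_eq_increments[OF \<open>a \<le> t\<close> g less_imp_neq[OF lam, symmetric]]
    by linarith
  then show ?thesis by (simp add: c_def mult_ac)
qed

text \<open>
  By the cocycle identity, moving the start from \<open>a\<close> to an earlier time changes the integral by the
  state reached at \<open>a\<close>, which is \<open>O(\<bar>a\<bar>)\<close>, times \<open>exp (- lam * (t - a))\<close>. So the integrals are
  Cauchy as \<open>a\<close> tends to minus infinity.
\<close>

lemma RS_integral_atMost_tendsto:
  assumes lam: "lam > 0" and g: "continuous_on UNIV g" and "eps \<le> 1" "A \<ge> 0"
    and growth: "\<And>t s. \<bar>g t - g s\<bar> \<le> A * (3 + \<bar>t\<bar>) powr eps * (2 + \<bar>t - s\<bar>)\<^sup>2"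
  shows "((\<lambda>a. OU_from lam g a t) \<longlongrightarrow> RS_integral_atMost (\<lambda>s. exp (- lam * (t - s))) g t) at_bot"
proof -
  define D where "D = 3 * (2 + 4 / lam)\<^sup>2 * A"
  have D: "D \<ge> 0" using \<open>A \<ge> 0\<close> by (simp add: D_def)
  have tail: "\<bar>OU_from lam g a' t - OU_from lam g a t\<bar> \<le> exp (- lam * (t - a)) * (D * (3 + \<bar>a\<bar>))"
    if "a' \<le> a" "a \<le> t" for a' a
  proof -
    have "\<bar>OU_from lam g a' a\<bar> \<le> 3 * (2 + 4 / lam)\<^sup>2 * (A * (3 + \<bar>a\<bar>) powr eps)"
      by (rule OU_from_bound[OF lam that(1) g growth])
    also have "\<dots> = D * (3 + \<bar>a\<bar>) powr eps" by (simp add: D_def)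
    also have "\<dots> \<le> D * (3 + \<bar>a\<bar>) powr 1"
      using D \<open>eps \<le> 1\<close> by (intro mult_left_mono powr_mono) auto
    finally have "\<bar>OU_from lam g a' a\<bar> \<le> D * (3 + \<bar>a\<bar>)" by simp
    then show ?thesis
      unfolding OU_from_cocycle[OF that g] by (simp add: abs_mult)
  qed
  have "((\<lambda>a. exp (- lam * (t - a)) * (D * (3 + \<bar>a\<bar>))) \<longlongrightarrow> 0) at_bot"
    using lam by real_asymp
  then have small: "\<forall>\<^sub>F a in at_bot. exp (- lam * (t - a)) * (D * (3 + \<bar>a\<bar>)) < e" if "e > 0" for e
    using that by (rule order_tendstoD)
  \<comment> \<open>The limit is found along \<open>a = - n\<close>; the tail estimate then extends it to real \<open>a\<close>.\<close>
  have "convergent (\<lambda>n. OU_from lam g (- real n) t)"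
  proof (rule Cauchy_convergent, rule CauchyI')
    fix e :: real assume "e > 0"
    obtain N where N: "\<And>a. a \<le> N \<Longrightarrow> exp (- lam * (t - a)) * (D * (3 + \<bar>a\<bar>)) < e"
      using small[OF \<open>e > 0\<close>] by (auto simp: eventually_at_bot_linorder)
    obtain n0 :: nat where n0: "real n0 \<ge> max (- N) (- t)" using real_arch_simple by blast
    show "\<exists>n0. \<forall>m\<ge>n0. \<forall>n>m. dist (OU_from lam g (- real m) t) (OU_from lam g (- real n) t) < e"
    proof (intro exI[of _ n0] allI impI)
      fix m n :: nat assume mn: "m \<ge> n0" "n > m"
      then have "\<bar>OU_from lam g (- real n) t - OU_from lam g (- real m) t\<bar> < e"
        using n0 tail[of "- real n" "- real m"] N[of "- real m"] by fastforce
      then show "dist (OU_from lam g (- real m) t) (OU_from lam g (- real n) t) < e"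
        by (simp add: dist_real_def abs_minus_commute)
    qed
  qed
  then obtain L where L: "(\<lambda>n. OU_from lam g (- real n) t) \<longlonglongrightarrow> L" by (auto simp: convergent_def)
  have bd: "\<bar>L - OU_from lam g a t\<bar> \<le> exp (- lam * (t - a)) * (D * (3 + \<bar>a\<bar>))" if "a \<le> t" for a
  proof (rule tendsto_upperbound)
    show "(\<lambda>n. \<bar>OU_from lam g (- real n) t - OU_from lam g a t\<bar>) \<longlonglongrightarrow> \<bar>L - OU_from lam g a t\<bar>"
      by (intro tendsto_intros L)
    have "\<forall>\<^sub>F n in sequentially. - real n \<le> a" by real_asymp
    then show "\<forall>\<^sub>F n in sequentially. \<bar>OU_from lam g (- real n) t - OU_from lam g a t\<bar>
        \<le> exp (- lam * (t - a)) * (D * (3 + \<bar>a\<bar>))"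
      by eventually_elim (rule tail[OF _ that])
  qed simp
  have "((\<lambda>a. OU_from lam g a t) \<longlongrightarrow> L) at_bot"
  proof (rule tendstoI)
    fix e :: real assume "e > 0"
    show "\<forall>\<^sub>F a in at_bot. dist (OU_from lam g a t) L < e"
      using small[OF \<open>e > 0\<close>] eventually_le_at_bot[of t]
    proof eventually_elim
      case (elim a)
      then show ?case using bd[of a] by (simp add: dist_real_def)
    qed
  qed
  moreover from this have "RS_integral_atMost (\<lambda>s. exp (- lam * (t - s))) g t = L"
    unfolding RS_integral_atMost_def OU_from_def
    by (intro tendsto_Lim trivial_limit_at_bot_linorder)
  ultimately show ?thesis by simp
qed

text \<open>
  Write \<open>E = exp (- lam * (t - s))\<close>. The cocycle identity gives
  \<open>Y t - Y s = - (1 - E) * Y s + OU_from s t\<close>. The first part is Lipschitz in \<open>t - s\<close>, with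
  constant \<open>lam * \<bar>Y s\<bar>\<close>, and the second inherits the modulus of continuity of \<open>g\<close>.
\<close>

lemma OU_integral_regularity:
  fixes g :: "real \<Rightarrow> real"
  defines "Y \<equiv> \<lambda>lam t. RS_integral_atMost (\<lambda>s. exp (- lam * (t - s))) g t"
  assumes lam: "lam > 0" and g: "continuous_on UNIV g"
    and eps: "0 \<le> eps" "eps \<le> 1" and "A \<ge> 0" and gam: "0 \<le> gam" "gam \<le> 1"
    and growth: "\<And>t s. \<bar>g t - g s\<bar> \<le> A * (3 + \<bar>t\<bar>) powr eps * (2 + \<bar>t - s\<bar>)\<^sup>2"
    and hoelder: "\<And>t s. \<bar>t - s\<bar> \<le> 1 \<Longrightarrow> \<bar>g t - g s\<bar> \<le> A * (3 + \<bar>t\<bar>) powr eps * \<bar>t - s\<bar> powr gam"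
  shows OU_integral_bound:
      "\<bar>Y lam t\<bar> \<le> 3 * (2 + 4 / lam)\<^sup>2 * A * (3 + \<bar>t\<bar>) powr eps"
    and OU_integral_hoelder: "0 \<le> s \<Longrightarrow> s \<le> t \<Longrightarrow> t - s \<le> 1 \<Longrightarrow>
      \<bar>Y lam t - Y lam s\<bar> \<le>
        (1 + lam + 3 * (2 + 4 / lam)\<^sup>2 * lam) * A * (3 + t) powr eps * (t - s) powr gam"
proof -
  have lim: "((\<lambda>a. OU_from lam g a t) \<longlongrightarrow> Y lam t) at_bot" for t
    unfolding Y_def by (rule RS_integral_atMost_tendsto[OF lam g eps(2) \<open>A \<ge> 0\<close> growth])
  have bound: "\<bar>Y lam t\<bar> \<le> 3 * (2 + 4 / lam)\<^sup>2 * A * (3 + \<bar>t\<bar>) powr eps" for t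
  proof (rule tendsto_upperbound)
    show "((\<lambda>a. \<bar>OU_from lam g a t\<bar>) \<longlongrightarrow> \<bar>Y lam t\<bar>) at_bot"
      by (intro tendsto_intros lim)
    show "\<forall>\<^sub>F a in at_bot. \<bar>OU_from lam g a t\<bar> \<le> 3 * (2 + 4 / lam)\<^sup>2 * A * (3 + \<bar>t\<bar>) powr eps"
      using eventually_le_at_bot[of t]
    proof eventually_elim
      case (elim a)
      show ?case using OU_from_bound[OF lam elim g growth] by (simp add: mult.assoc)
    qed
  qed (rule trivial_limit_at_bot_linorder)
  show "\<bar>Y lam t\<bar> \<le> 3 * (2 + 4 / lam)\<^sup>2 * A * (3 + \<bar>t\<bar>) powr eps"
    by (rule bound)
  assume st: "0 \<le> s" "s \<le> t" "t - s \<le> 1"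
  define k where "k = 3 * (2 + 4 / lam)\<^sup>2"
  have k: "k \<ge> 0" by (simp add: k_def)
  define W where "W = A * (3 + t) powr eps"
  define h where "h = (t - s) powr gam"
  have W: "W \<ge> 0" using \<open>A \<ge> 0\<close> by (simp add: W_def)
  have h: "h \<ge> 0" "t - s \<le> h"
    using powr_mono'[of gam 1 "t - s"] st gam by (cases "s = t"; simp add: h_def)+
  have osc: "\<bar>g t - g r\<bar> \<le> W * h" if "r \<in> {s..t}" for r
  proof -
    have "\<bar>g t - g r\<bar> \<le> W * \<bar>t - r\<bar> powr gam"
      using hoelder[of t r] that st by (simp add: W_def)
    also have "\<dots> \<le> W * h"
      unfolding h_def using W that gam by (intro mult_left_mono powr_mono2) auto
    finally show ?thesis .
  qed
  have "\<bar>Y lam s\<bar> \<le> k * (A * (3 + s) powr eps)"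
    using bound[of s] st by (simp add: k_def mult.assoc)
  also have "\<dots> \<le> k * W"
    unfolding W_def using st eps k \<open>A \<ge> 0\<close> by (intro mult_left_mono powr_mono2) auto
  finally have Ys: "\<bar>Y lam s\<bar> \<le> k * W" .
  show "\<bar>Y lam t - Y lam s\<bar> \<le>
        (1 + lam + 3 * (2 + 4 / lam)\<^sup>2 * lam) * A * (3 + t) powr eps * (t - s) powr gam"
  proof -
    define E where "E = exp (- lam * (t - s))"
    define J where "J = integral {s..t} (\<lambda>r. lam * exp (- lam * (t - r)) * (g t - g r))"
    have E: "0 \<le> E" "E \<le> 1" using lam st by (auto simp: E_def)
    have "1 - E \<le> lam * (t - s)"
      using exp_ge_add_one_self[of "- lam * (t - s)"] by (simp add: E_def)
    also have "\<dots> \<le> lam * h" using lam h by (intro mult_left_mono) auto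
    finally have E': "1 - E \<le> lam * h" .
    have "\<forall>\<^sub>F a in at_bot. OU_from lam g a t = E * OU_from lam g a s + OU_from lam g s t"
      using eventually_le_at_bot[of s]
      by eventually_elim (unfold E_def, rule OU_from_cocycle[OF _ st(2) g])
    then have "((\<lambda>a. E * OU_from lam g a s + OU_from lam g s t) \<longlongrightarrow> Y lam t) at_bot"
      by (rule Lim_transform_eventually[OF lim])
    moreover have "((\<lambda>a. E * OU_from lam g a s + OU_from lam g s t) \<longlongrightarrow>
        E * Y lam s + OU_from lam g s t) at_bot"
      by (intro tendsto_intros lim)
    ultimately have "Y lam t = E * Y lam s + OU_from lam g s t"
      by (rule tendsto_unique[OF trivial_limit_at_bot_linorder])
    moreover have "OU_from lam g s t = (g t - g s) * E + J"
      unfolding E_def J_def using lam by (intro OU_from_eq_increments[OF st(2) g]) auto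
    ultimately have split: "Y lam t - Y lam s = - ((1 - E) * Y lam s) + (g t - g s) * E + J"
      by algebra
    have "\<bar>(1 - E) * Y lam s\<bar> \<le> (lam * h) * (k * W)"
      unfolding abs_mult using E E' Ys W lam h by (intro mult_mono) auto
    moreover have "\<bar>(g t - g s) * E\<bar> \<le> (W * h) * 1"
      unfolding abs_mult using E osc[of s] st by (intro mult_mono) auto
    moreover have "\<bar>J\<bar> \<le> lam * (W * h) * (t - s)"
      unfolding J_def
    proof (rule abs_integral_le_const[OF st(2)])
      show "continuous_on {s..t} (\<lambda>r. lam * exp (- lam * (t - r)) * (g t - g r))"
        by (intro continuous_intros continuous_on_subset[OF g]) auto
      fix r assume r: "r \<in> {s..t}"
      have "lam * exp (- lam * (t - r)) * \<bar>g t - g r\<bar> \<le> lam * 1 * (W * h)"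
        using lam r osc[OF r] by (intro mult_mono) auto
      then show "\<bar>lam * exp (- lam * (t - r)) * (g t - g r)\<bar> \<le> lam * (W * h)"
        using lam by (simp add: abs_mult)
    qed
    moreover have "lam * (W * h) * (t - s) \<le> lam * (W * h) * 1"
      using st W h lam by (intro mult_left_mono) auto
    ultimately have "\<bar>Y lam t - Y lam s\<bar> \<le>
        (lam * h) * (k * W) + W * h + lam * (W * h)"
      unfolding split by linarith
    also have "\<dots> = (1 + lam + k * lam) * W * h"
      by (simp add: algebra_simps)
    finally show ?thesis by (simp only: W_def h_def k_def mult.assoc)
  qed
qed

section \<open>Chaining: from dyadic increments to Hoelder bounds\<close>

definition dyadic_approx :: "nat \<Rightarrow> real \<Rightarrow> real" where
  "dyadic_approx n t = real_of_int \<lfloor>2 ^ n * t\<rfloor> / 2 ^ n"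

lemma dyadic_approx_bounds: "dyadic_approx n t \<le> t" "t - 1 / 2 ^ n < dyadic_approx n t"
proof -
  have "real_of_int \<lfloor>2 ^ n * t\<rfloor> \<le> 2 ^ n * t" "2 ^ n * t < real_of_int \<lfloor>2 ^ n * t\<rfloor> + 1" by linarith+
  then show "dyadic_approx n t \<le> t" "t - 1 / 2 ^ n < dyadic_approx n t"
    by (simp_all add: dyadic_approx_def pos_divide_le_eq pos_less_divide_eq left_diff_distrib right_diff_distrib mult.commute)
qed

lemma dyadic_approx_tendsto: "(\<lambda>n. dyadic_approx n t) \<longlonglongrightarrow> t"
proof (rule tendsto_sandwich)
  show "(\<lambda>n. t - (1 / 2) ^ n) \<longlonglongrightarrow> t"
    using tendsto_diff[OF tendsto_const LIMSEQ_realpow_zero[of "1/2::real"]] by simp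
  show "\<forall>\<^sub>F n in sequentially. t - (1 / 2) ^ n \<le> dyadic_approx n t"
    using dyadic_approx_bounds(2) by (auto simp: power_one_over less_imp_le)
qed (use dyadic_approx_bounds(1) in auto)

lemma ex_dyadic_scale:
  assumes "0 < (x::real)" "x \<le> 1"
  obtains n :: nat where "1 / 2 ^ Suc n < x" "x \<le> 1 / 2 ^ n"
proof -
  obtain m :: nat where m: "(1 / 2) ^ m < x" using real_arch_pow_inv[of x "1/2"] assms by auto
  define k where "k = (LEAST m. (1 / 2 :: real) ^ m < x)"
  have k: "(1 / 2) ^ k < x" unfolding k_def by (rule LeastI[of _ m]) (rule m)
  with assms obtain n where n: "k = Suc n" by (cases k) auto
  have "\<not> (1 / 2) ^ n < x" using not_less_Least[of n "\<lambda>m. (1 / 2 :: real) ^ m < x"] n by (simp add: k_def)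
  with k n that show ?thesis by (auto simp: power_one_over)
qed

definition chaining_const :: "real \<Rightarrow> real" where
  "chaining_const gam = (1 + 2 * (2 powr (- gam) / (1 - 2 powr (- gam)))) * 2 powr gam"

text \<open>
  The deterministic half of the continuity criterion. The weight \<open>(1 + \<bar>k\<bar> / 2 ^ n) powr eps\<close>
  lets the Hoelder constant grow slowly along the line, so that one constant \<open>K\<close> can serve a path on
  all of it.
\<close>

locale dyadic_hoelder =
  fixes f :: "real \<Rightarrow> real" and K gam eps :: real
  assumes cont: "continuous_on UNIV f"
    and K: "K \<ge> 0" and gam: "gam > 0" and eps: "0 \<le> eps" "eps \<le> 1"
    and dyadic: "\<And>n k. \<bar>f (real_of_int (k + 1) / 2 ^ n) - f (real_of_int k / 2 ^ n)\<bar>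
        \<le> K * (1 + \<bar>real_of_int k\<bar> / 2 ^ n) powr eps * (2 powr (- gam)) ^ n"
begin

abbreviation "q \<equiv> 2 powr (- gam)"

lemma q: "0 < q" "q < 1" using gam by (auto simp: powr_minus inverse_less_1_iff)

abbreviation "hoelder_const \<equiv> K * chaining_const gam"

lemma hoelder_const_nonneg: "hoelder_const \<ge> 0"
  using K q by (auto simp: chaining_const_def intro!: mult_nonneg_nonneg add_nonneg_nonneg)

lemma dyadic_step:
  assumes "real_of_int j = real_of_int k \<or> real_of_int j = real_of_int k + 1"
    and "\<bar>real_of_int k / 2 ^ n\<bar> \<le> R"
  shows "\<bar>f (real_of_int j / 2 ^ n) - f (real_of_int k / 2 ^ n)\<bar> \<le> K * (1 + R) powr eps * q ^ n"
proof (cases "j = k")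
  case True
  then show ?thesis using K q by (simp add: mult_nonneg_nonneg)
next
  case False
  then have j: "j = k + 1" using assms(1) by auto
  have "K * (1 + \<bar>real_of_int k\<bar> / 2 ^ n) powr eps * q ^ n \<le> K * (1 + R) powr eps * q ^ n"
    using assms(2) K eps q
    by (intro mult_right_mono mult_left_mono powr_mono2) (auto simp: abs_divide)
  then show ?thesis using dyadic[of k n] unfolding j by linarith
qed

lemma dyadic_refine:
  "\<bar>f (dyadic_approx (Suc n) t) - f (dyadic_approx n t)\<bar> \<le> K * (2 + \<bar>t\<bar>) powr eps * q ^ Suc n"
proof -
  have 1: "dyadic_approx n t = real_of_int (2 * \<lfloor>2 ^ n * t\<rfloor>) / 2 ^ Suc n"
    by (simp add: dyadic_approx_def)
  have 2: "\<lfloor>2 ^ Suc n * t\<rfloor> = 2 * \<lfloor>2 ^ n * t\<rfloor> \<or> \<lfloor>2 ^ Suc n * t\<rfloor> = 2 * \<lfloor>2 ^ n * t\<rfloor> + 1"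
  proof -
    have "2 ^ Suc n * t = 2 * (2 ^ n * t)" by simp
    then show ?thesis by linarith
  qed
  have "1 / 2 ^ n \<le> (1::real)" by simp
  then have "\<bar>dyadic_approx n t\<bar> \<le> 1 + \<bar>t\<bar>" using dyadic_approx_bounds[where n=n and t=t] by linarith
  then show ?thesis
    unfolding dyadic_approx_def[of "Suc n"] unfolding 1
    using dyadic_step[of "\<lfloor>2 ^ Suc n * t\<rfloor>" "2 * \<lfloor>2 ^ n * t\<rfloor>" "Suc n" "1 + \<bar>t\<bar>"] 2
    by (auto simp del: power_Suc)
qed

text \<open>
  Successive dyadic approximations of \<open>t\<close> cost a geometric series, whose tail from scale \<open>n\<close> on is
  \<open>(q / (1 - q)) * q ^ n\<close>.
\<close>

lemma dyadic_chain:
  "\<bar>f t - f (dyadic_approx n t)\<bar> \<le> K * (2 + \<bar>t\<bar>) powr eps * (q / (1 - q)) * q ^ n"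
proof -
  define W where "W = K * (2 + \<bar>t\<bar>) powr eps"
  have W: "W \<ge> 0" using K by (simp add: W_def)
  have part: "\<bar>f (dyadic_approx (n + m) t) - f (dyadic_approx n t)\<bar> \<le> W * (q / (1 - q)) * (q ^ n - q ^ (n + m))" for m
  proof (induction m)
    case (Suc m)
    have "\<bar>f (dyadic_approx (n + Suc m) t) - f (dyadic_approx (n + m) t)\<bar> \<le> W * q ^ Suc (n + m)"
      using dyadic_refine[of "n + m" t] by (simp add: W_def)
    also have "\<dots> = W * (q / (1 - q)) * (q ^ (n + m) - q ^ (n + Suc m))"
    proof -
      have "q ^ (n + m) - q ^ (n + Suc m) = (1 - q) * q ^ (n + m)" by (simp add: left_diff_distrib)
      then show ?thesis using q gam by simp
    qed
    finally show ?case using Suc by (simp add: right_diff_distrib)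
  qed simp
  show ?thesis
  proof (rule tendsto_upperbound)
    have "isCont f t" using cont by (simp add: continuous_on_eq_continuous_at)
    then have "(\<lambda>m. f (dyadic_approx m t)) \<longlonglongrightarrow> f t"
      by (rule isCont_tendsto_compose) (rule dyadic_approx_tendsto)
    then have "(\<lambda>m. f (dyadic_approx (n + m) t)) \<longlonglongrightarrow> f t"
      by (subst add.commute) (rule LIMSEQ_ignore_initial_segment)
    then show "(\<lambda>m. \<bar>f (dyadic_approx (n + m) t) - f (dyadic_approx n t)\<bar>) \<longlonglongrightarrow> \<bar>f t - f (dyadic_approx n t)\<bar>"
      by (intro tendsto_intros)
    have "W * (q / (1 - q)) * (q ^ n - q ^ (n + m)) \<le> W * (q / (1 - q)) * q ^ n" for m
      using W q by (intro mult_left_mono) auto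
    then show "\<forall>\<^sub>F m in sequentially. \<bar>f (dyadic_approx (n + m) t) - f (dyadic_approx n t)\<bar>
        \<le> K * (2 + \<bar>t\<bar>) powr eps * (q / (1 - q)) * q ^ n"
      using part unfolding W_def by (intro always_eventually allI order_trans[OF part[unfolded W_def]]) auto
  qed simp
qed

text \<open>
  At the scale \<open>n\<close> with \<open>2\<^sup>-\<^sup>n\<close> comparable to \<open>t - s\<close>, the approximations of \<open>s\<close> and \<open>t\<close> are equal or
  neighbours; this costs one dyadic increment and two chains.
\<close>

lemma hoelder_ordered:
  assumes "s < t" "t - s \<le> 1" and R: "\<bar>s\<bar> \<le> R" "\<bar>t\<bar> \<le> R"
  shows "\<bar>f t - f s\<bar> \<le> hoelder_const * (2 + R) powr eps * (t - s) powr gam"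
proof -
  define W where "W = K * (2 + R) powr eps"
  have W: "W \<ge> 0" using K by (simp add: W_def)
  obtain n :: nat where n: "1 / 2 ^ Suc n < t - s" "t - s \<le> 1 / 2 ^ n"
    using ex_dyadic_scale[of "t - s"] assms by auto
  have chain: "\<bar>f x - f (dyadic_approx n x)\<bar> \<le> W * (q / (1 - q)) * q ^ n" if "\<bar>x\<bar> \<le> R" for x
  proof -
    have "K * (2 + \<bar>x\<bar>) powr eps \<le> W"
      unfolding W_def using K eps that by (intro mult_left_mono powr_mono2) auto
    then have "K * (2 + \<bar>x\<bar>) powr eps * (q / (1 - q)) * q ^ n \<le> W * (q / (1 - q)) * q ^ n"
      using q by (intro mult_right_mono) auto
    then show ?thesis using dyadic_chain[of x n] by linarith
  qed
  have "2 ^ n * s \<le> 2 ^ n * t" "2 ^ n * t \<le> 2 ^ n * s + 1"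
    using n(2) assms(1) by (simp_all add: field_simps)
  then have floors: "\<lfloor>2 ^ n * t\<rfloor> = \<lfloor>2 ^ n * s\<rfloor> \<or> \<lfloor>2 ^ n * t\<rfloor> = \<lfloor>2 ^ n * s\<rfloor> + 1" by linarith
  have "1 / 2 ^ n \<le> (1::real)" by simp
  then have "\<bar>dyadic_approx n s\<bar> \<le> 1 + R" using dyadic_approx_bounds[where n=n and t=s] R by linarith
  then have mid: "\<bar>f (dyadic_approx n t) - f (dyadic_approx n s)\<bar> \<le> W * q ^ n"
    unfolding dyadic_approx_def W_def
    using dyadic_step[of "\<lfloor>2 ^ n * t\<rfloor>" "\<lfloor>2 ^ n * s\<rfloor>" n "1 + R"] floors by auto
  have "q ^ n = 2 powr gam * (1 / 2 ^ Suc n) powr gam"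
  proof -
    have "1 / 2 ^ Suc n = (2::real) powr (- real (Suc n))"
      by (simp add: powr_minus powr_realpow divide_inverse del: of_nat_Suc power_Suc)
    then have "2 powr gam * (1 / 2 ^ Suc n) powr gam = (2::real) powr (gam + - real (Suc n) * gam)"
      by (simp only: powr_powr powr_add)
    also have "gam + - real (Suc n) * gam = - gam * real n" by (simp add: algebra_simps)
    also have "(2::real) powr (- gam * real n) = q ^ n"
      by (simp only: powr_powr[symmetric] powr_realpow[OF q(1)])
    finally show ?thesis by simp
  qed
  also have "\<dots> \<le> 2 powr gam * (t - s) powr gam"
    using n gam by (intro mult_left_mono powr_mono2) auto
  finally have qn: "q ^ n \<le> 2 powr gam * (t - s) powr gam" .
  have "\<bar>f t - f s\<bar> \<le> W * q ^ n + 2 * (W * (q / (1 - q)) * q ^ n)"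
    using mid chain[OF R(1)] chain[OF R(2)] by linarith
  also have "\<dots> = W * (1 + 2 * (q / (1 - q))) * q ^ n" by (simp only: algebra_simps)
  also have "\<dots> \<le> W * (1 + 2 * (q / (1 - q))) * (2 powr gam * (t - s) powr gam)"
    using qn W q by (intro mult_left_mono) auto
  finally show ?thesis by (simp add: chaining_const_def W_def mult_ac)
qed

lemma hoelder:
  assumes "\<bar>t - s\<bar> \<le> 1"
  shows "\<bar>f t - f s\<bar> \<le> hoelder_const * (3 + \<bar>t\<bar>) powr eps * \<bar>t - s\<bar> powr gam"
  using hoelder_ordered[of s t "1 + \<bar>t\<bar>"] hoelder_ordered[of t s "1 + \<bar>t\<bar>"] assms
  by (cases s t rule: linorder_cases) (auto simp: abs_minus_commute[of "f t"])

text \<open>Long increments are cut into unit steps.\<close>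

lemma growth_aux:
  assumes "\<bar>t - s\<bar> \<le> real n"
  shows "\<bar>f t - f s\<bar> \<le> hoelder_const * (3 + (\<bar>t\<bar> + real n)) powr eps * real n"
  using assms
proof (induction n arbitrary: s)
  case (Suc n)
  \<comment> \<open>\<open>s'\<close> lies one unit closer to \<open>t\<close> than \<open>s\<close>, or is \<open>t\<close> itself.\<close>
  define s' where "s' = (if s \<le> t then min t (s + 1) else max t (s - 1))"
  have s': "\<bar>t - s'\<bar> \<le> real n" "\<bar>s - s'\<bar> \<le> 1" "\<bar>s\<bar> \<le> \<bar>t\<bar> + real (Suc n)"
    using Suc.prems by (auto simp: s'_def min_def max_def)
  define W where "W = hoelder_const * (3 + (\<bar>t\<bar> + real (Suc n))) powr eps"
  have W: "hoelder_const * (3 + x) powr eps \<le> W" if "0 \<le> x" "x \<le> \<bar>t\<bar> + real (Suc n)" for x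
    unfolding W_def using that eps hoelder_const_nonneg by (intro mult_left_mono powr_mono2) auto
  have W0: "0 \<le> W" using hoelder_const_nonneg by (simp add: W_def)
  have "\<bar>f t - f s'\<bar> \<le> W * real n"
    using Suc.IH[OF s'(1)] mult_right_mono[OF W[of "\<bar>t\<bar> + real n"], of "real n"] by auto
  moreover have "\<bar>f s - f s'\<bar> \<le> W * 1"
  proof -
    have "\<bar>f s - f s'\<bar> \<le> hoelder_const * (3 + \<bar>s\<bar>) powr eps * \<bar>s - s'\<bar> powr gam"
      by (rule hoelder[OF s'(2)])
    also have "\<dots> \<le> W * 1"
      using s' W[of "\<bar>s\<bar>"] W0 gam by (intro mult_mono powr_le1) auto
    finally show ?thesis .
  qed
  ultimately show ?case unfolding W_def[symmetric] by (simp add: algebra_simps)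
qed (simp add: hoelder_const_nonneg)

text \<open>
  The form required of an integrand for the exponential kernel: the weight depends on the end point
  \<open>t\<close> alone, and the price is a polynomial in \<open>\<bar>t - s\<bar>\<close>.
\<close>

lemma growth: "\<bar>f t - f s\<bar> \<le> hoelder_const * (3 + \<bar>t\<bar>) powr eps * (2 + \<bar>t - s\<bar>)\<^sup>2"
proof -
  define n where "n = nat \<lceil>\<bar>t - s\<bar>\<rceil>"
  have n: "\<bar>t - s\<bar> \<le> real n" "real n \<le> 1 + \<bar>t - s\<bar>" unfolding n_def by linarith+
  have "3 + (\<bar>t\<bar> + real n) \<le> (3 + \<bar>t\<bar>) * (1 + real n)" by (simp add: algebra_simps)
  then have "(3 + (\<bar>t\<bar> + real n)) powr eps \<le> ((3 + \<bar>t\<bar>) * (1 + real n)) powr eps"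
    using eps by (intro powr_mono2) auto
  also have "\<dots> \<le> (3 + \<bar>t\<bar>) powr eps * (1 + real n)"
    using powr_mono[of eps 1 "1 + real n"] eps by (auto simp: powr_mult intro!: mult_left_mono)
  finally have "(3 + (\<bar>t\<bar> + real n)) powr eps * real n \<le> (3 + \<bar>t\<bar>) powr eps * (1 + real n) * real n"
    by (intro mult_right_mono) auto
  also have "\<dots> \<le> (3 + \<bar>t\<bar>) powr eps * (2 + \<bar>t - s\<bar>)\<^sup>2"
    unfolding power2_eq_square mult.assoc using n by (intro mult_left_mono mult_mono) auto
  finally have "hoelder_const * ((3 + (\<bar>t\<bar> + real n)) powr eps * real n)
      \<le> hoelder_const * ((3 + \<bar>t\<bar>) powr eps * (2 + \<bar>t - s\<bar>)\<^sup>2)"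
    using hoelder_const_nonneg by (intro mult_left_mono)
  then show ?thesis using growth_aux[OF n(1)] by (simp add: mult.assoc)
qed

end

section \<open>Moments of Gaussian increments\<close>

lemma std_normal_distribution_centred: "(LINT x|std_normal_distribution. x) = 0"
  using integral_std_normal_distribution_moment_odd[of 1] by simp

text \<open>All moments of a Gaussian variable are those of an affine function of a standard normal one.\<close>

lemma gaussian_rv_integral:
  assumes "gaussian_rv M Y"
  obtains \<mu> \<tau> where "\<And>h :: real \<Rightarrow> real. h \<in> borel_measurable borel \<Longrightarrow>
      (LINT \<omega>|M. h (Y \<omega>)) = (LINT x|std_normal_distribution. h (\<mu> + \<tau> * x))"
    and "\<And>h :: real \<Rightarrow> real. h \<in> borel_measurable borel \<Longrightarrow>
      integrable M (\<lambda>\<omega>. h (Y \<omega>)) \<longleftrightarrow> integrable std_normal_distribution (\<lambda>x. h (\<mu> + \<tau> * x))"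
proof -
  obtain \<mu> \<tau> where Y: "Y \<in> borel_measurable M"
    and d: "distr M borel Y = distr std_normal_distribution borel (\<lambda>x. \<mu> + \<tau> * x)"
    using assms by (auto simp: gaussian_rv_def)
  have aff: "(\<lambda>x. \<mu> + \<tau> * x) \<in> borel_measurable std_normal_distribution" by simp
  show ?thesis
  proof (rule that[of \<mu> \<tau>])
    fix h :: "real \<Rightarrow> real" assume h: "h \<in> borel_measurable borel"
    show "(LINT \<omega>|M. h (Y \<omega>)) = (LINT x|std_normal_distribution. h (\<mu> + \<tau> * x))"
      using integral_distr[OF Y h] integral_distr[OF aff h] d by simp
    show "integrable M (\<lambda>\<omega>. h (Y \<omega>)) \<longleftrightarrow> integrable std_normal_distribution (\<lambda>x. h (\<mu> + \<tau> * x))"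
      using integrable_distr_eq[OF Y h] integrable_distr_eq[OF aff h] d by simp
  qed
qed

lemma gaussian_rv_integrable:
  assumes "gaussian_rv M Y"
  shows "integrable M Y"
proof -
  interpret N: prob_space std_normal_distribution
    using real_dist_normal_dist by (simp add: real_distribution_def)
  obtain \<mu> \<tau> where I: "integrable M Y \<longleftrightarrow> integrable std_normal_distribution (\<lambda>x. \<mu> + \<tau> * x)"
  proof (rule gaussian_rv_integral[OF assms])
    fix \<mu> \<tau>
    assume "\<And>h :: real \<Rightarrow> real. h \<in> borel_measurable borel \<Longrightarrow>
      integrable M (\<lambda>\<omega>. h (Y \<omega>)) \<longleftrightarrow> integrable std_normal_distribution (\<lambda>x. h (\<mu> + \<tau> * x))"
    from this[of "\<lambda>x. x"] show thesis by (intro that[of \<mu> \<tau>]) simp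
  qed
  show ?thesis
    unfolding I using integrable_std_normal_distribution_moment[of 1]
    by (intro Bochner_Integration.integrable_add integrable_mult_right) auto
qed

lemma centred_gaussian_even_moment:
  assumes "gaussian_rv M Y" and centred: "(LINT \<omega>|M. Y \<omega>) = 0"
  shows "integrable M (\<lambda>\<omega>. Y \<omega> ^ (2 * m))"
    and "(LINT \<omega>|M. Y \<omega> ^ (2 * m)) = fact (2 * m) / (2 ^ m * fact m) * (LINT \<omega>|M. (Y \<omega>)\<^sup>2) ^ m"
proof -
  interpret N: prob_space std_normal_distribution
    using real_dist_normal_dist by (simp add: real_distribution_def)
  obtain \<mu> \<tau> where
    E: "\<And>h :: real \<Rightarrow> real. h \<in> borel_measurable borel \<Longrightarrow>
      (LINT \<omega>|M. h (Y \<omega>)) = (LINT x|std_normal_distribution. h (\<mu> + \<tau> * x))"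
    and I: "\<And>h :: real \<Rightarrow> real. h \<in> borel_measurable borel \<Longrightarrow>
      integrable M (\<lambda>\<omega>. h (Y \<omega>)) \<longleftrightarrow> integrable std_normal_distribution (\<lambda>x. h (\<mu> + \<tau> * x))"
    using gaussian_rv_integral[OF assms(1)] by metis
  have "integrable std_normal_distribution (\<lambda>x. x)"
    using integrable_std_normal_distribution_moment[of 1] by simp
  then have "(LINT x|std_normal_distribution. \<mu> + \<tau> * x) = \<mu>"
    using N.prob_space by (simp add: std_normal_distribution_centred)
  then have \<mu>: "\<mu> = 0" using E[of "\<lambda>x. x"] centred by simp
  have mom: "(LINT \<omega>|M. Y \<omega> ^ (2 * k)) = \<tau> ^ (2 * k) * (fact (2 * k) / (2 ^ k * fact k))" for k
    using E[of "\<lambda>x. x ^ (2 * k)"] std_normal_distribution_even_moments[of k]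
    by (simp add: \<mu> power_mult_distrib)
  show "integrable M (\<lambda>\<omega>. Y \<omega> ^ (2 * m))"
    using I[of "\<lambda>x. x ^ (2 * m)"] std_normal_distribution_even_moments(2)[of m]
    by (simp add: \<mu> power_mult_distrib)
  show "(LINT \<omega>|M. Y \<omega> ^ (2 * m)) = fact (2 * m) / (2 ^ m * fact m) * (LINT \<omega>|M. (Y \<omega>)\<^sup>2) ^ m"
  proof -
    have "(LINT \<omega>|M. (Y \<omega>)\<^sup>2) = \<tau>\<^sup>2" using mom[of 1] by (simp add: fact_numeral)
    then have "(LINT \<omega>|M. (Y \<omega>)\<^sup>2) ^ m = \<tau> ^ (2 * m)" by (simp only: power_mult)
    then show ?thesis using mom[of m] by (simp only: mult.commute)
  qed
qed

text \<open>
  The increment over \<open>[s, t]\<close> is centred Gaussian, so its second moment determines the others.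
\<close>

lemma (in fractional_brownian_motion) increment_moment:
  assumes "m > 0"
  shows "(\<integral>\<^sup>+ \<omega>. ennreal (\<bar>B t \<omega> - B s \<omega>\<bar> ^ (2 * m)) \<partial>M)
    \<le> ennreal (fact (2 * m) / (2 ^ m * fact m) * \<bar>t - s\<bar> powr (real (2 * m) * H))"
proof (cases "s = t")
  case True
  then show ?thesis using assms by simp
next
  case False
  have rv: "gaussian_rv M (\<lambda>\<omega>. \<Sum>i\<in>J. c i * B i \<omega>)" if "finite J" for J c
    using gaussian that by (auto simp: gaussian_process_def)
  have G: "gaussian_rv M (\<lambda>\<omega>. B t \<omega> - B s \<omega>)"
    using rv[of "{s, t}" "\<lambda>i. if i = t then 1 else -1"] False by simp
  have int: "integrable M (B r)" for r
    using gaussian_rv_integrable[OF rv[of "{r}" "\<lambda>_. 1"]] by simp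
  have "expectation (\<lambda>\<omega>. B t \<omega> - B s \<omega>) = 0"
    using int centred by simp
  note mom = centred_gaussian_even_moment[OF G this, of m]
  have "expectation (\<lambda>\<omega>. (B t \<omega> - B s \<omega>)\<^sup>2) = \<bar>t - s\<bar> powr (2 * H)"
    using increments[of t s] by simp
  then have "expectation (\<lambda>\<omega>. (B t \<omega> - B s \<omega>) ^ (2 * m))
      = fact (2 * m) / (2 ^ m * fact m) * (\<bar>t - s\<bar> powr (2 * H)) ^ m"
    using mom(2) by simp
  also have "(\<bar>t - s\<bar> powr (2 * H)) ^ m = \<bar>t - s\<bar> powr (real (2 * m) * H)"
    using False by (simp add: powr_realpow[symmetric] powr_powr mult_ac)
  finally show ?thesis
    using nn_integral_eq_integral[OF mom(1)] by (simp add: power_even_abs)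
qed

section \<open>Simultaneous control of all dyadic increments\<close>

lemma le_suminf_ennreal: "(f i :: ennreal) \<le> (\<Sum>i. f i)"
  using sum_le_suminf[of f "{i}"] by simp

text \<open>
  \<open>S\<close> is the sum, over all scales and all dyadic points of the line, of the \<open>p\<close>-th powers of the
  weighted increments. Its expectation is finite, and each of its terms bounds one increment. A power
  \<open>p\<close> with \<open>p * eps \<ge> 2\<close> makes the weights summable over the points of one scale, up to the factor
  \<open>4 ^ n\<close>; the surplus \<open>p * (H - gam) \<ge> 3\<close> pays for that factor and leaves \<open>(1 / 2) ^ n\<close>, which is
  summable over the scales. The random constant is \<open>1 + S\<close>, since \<open>y ^ p \<le> S\<close> implies \<open>y \<le> 1 + S\<close>.
\<close>

lemma dyadic_increments_weighted_bound:
  fixes B :: "real \<Rightarrow> 'a \<Rightarrow> real"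
  assumes meas[measurable]: "\<And>t. B t \<in> borel_measurable M"
    and moment: "\<And>s t. (\<integral>\<^sup>+ \<omega>. ennreal (\<bar>B t \<omega> - B s \<omega>\<bar> ^ p) \<partial>M) \<le> ennreal (c * \<bar>t - s\<bar> powr (real p * H))"
    and "c \<ge> 0" and p: "p > 0" "2 \<le> real p * eps" "3 \<le> real p * (H - gam)"
  obtains K where "K \<in> borel_measurable M" "\<And>\<omega>. K \<omega> \<ge> 0"
    "AE \<omega> in M. \<forall>n k. \<bar>B (real_of_int (k + 1) / 2 ^ n) \<omega> - B (real_of_int k / 2 ^ n) \<omega>\<bar>
        \<le> K \<omega> * (1 + \<bar>real_of_int k\<bar> / 2 ^ n) powr eps * (2 powr (- gam)) ^ n"
proof -
  define D where "D n k \<omega> = \<bar>B (real_of_int (k + 1) / 2 ^ n) \<omega> - B (real_of_int k / 2 ^ n) \<omega>\<bar>"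
    for n :: nat and k :: int and \<omega>
  define w where "w n k = (1 + \<bar>real_of_int k\<bar> / 2 ^ n) powr eps * (2 powr (- gam)) ^ n" for n :: nat and k :: int
  have [measurable]: "D n k \<in> borel_measurable M" for n k
  proof -
    have "D n k = (\<lambda>\<omega>. \<bar>B (real_of_int (k + 1) / 2 ^ n) \<omega> - B (real_of_int k / 2 ^ n) \<omega>\<bar>)"
      by (simp add: fun_eq_iff D_def)
    then show ?thesis by simp
  qed
  have D: "D n k \<omega> \<ge> 0" for n k \<omega> by (simp add: D_def)
  have w: "w n k > 0" for n k
  proof -
    have "1 + \<bar>real_of_int k\<bar> / 2 ^ n > 0" by (intro add_pos_nonneg) auto
    then show ?thesis unfolding w_def by (intro mult_pos_pos zero_less_power) simp_all
  qed
  define S where "S \<omega> = (\<Sum>n. \<Sum>j. ennreal ((D n (int j) \<omega> / w n (int j)) ^ p)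
      + ennreal ((D n (- int j) \<omega> / w n (- int j)) ^ p))" for \<omega>
  have [measurable]: "S \<in> borel_measurable M"
    unfolding S_def[abs_def] by measurable
  have each: "(\<integral>\<^sup>+ \<omega>. ennreal ((D n k \<omega> / w n k) ^ p) \<partial>M) \<le> ennreal (c * (1 / 2) ^ n * (1 / (1 + \<bar>real_of_int k\<bar>)\<^sup>2))"
    for n k
  proof -
    define x :: real where "x = 2 ^ n"
    have x: "x \<ge> 1" by (simp add: x_def)
    have pos: "1 + \<bar>real_of_int k\<bar> / x > 0" using x by (intro add_pos_nonneg) auto
    have wp: "(1 + \<bar>real_of_int k\<bar>)\<^sup>2 / x powr (2 + real p * gam) \<le> w n k ^ p"
    proof -
      \<comment> \<open>The crude bound \<open>1 + \<bar>k\<bar> / x \<ge> (1 + \<bar>k\<bar>) / x\<close> separates the scale from the position.\<close>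
      have "((1 + \<bar>real_of_int k\<bar>) / x)\<^sup>2 \<le> (1 + \<bar>real_of_int k\<bar> / x)\<^sup>2"
        using x by (intro power_mono) (auto simp: field_simps)
      also have "\<dots> = (1 + \<bar>real_of_int k\<bar> / x) powr 2"
        using pos by simp
      also have "\<dots> \<le> (1 + \<bar>real_of_int k\<bar> / x) powr (real p * eps)"
        using x p by (intro powr_mono) auto
      finally have "((1 + \<bar>real_of_int k\<bar>) / x)\<^sup>2 * x powr (- (real p * gam))
          \<le> (1 + \<bar>real_of_int k\<bar> / x) powr (real p * eps) * x powr (- (real p * gam))"
        by (rule mult_right_mono) simp
      also have "\<dots> = w n k ^ p"
      proof -
        have "(2 powr (- gam)) ^ n = x powr (- gam)"
          by (simp add: x_def powr_realpow[symmetric] powr_powr mult.commute)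
        moreover have "((1 + \<bar>real_of_int k\<bar> / x) powr eps) ^ p = (1 + \<bar>real_of_int k\<bar> / x) powr (real p * eps)"
          using pos by (subst powr_realpow[symmetric]) (auto simp: powr_powr mult.commute)
        moreover have "(x powr (- gam)) ^ p = x powr (- (real p * gam))"
          using x by (subst powr_realpow[symmetric]) (auto simp: powr_powr mult.commute)
        ultimately show ?thesis by (simp add: w_def x_def[symmetric] power_mult_distrib)
      qed
      also have "((1 + \<bar>real_of_int k\<bar>) / x)\<^sup>2 * x powr (- (real p * gam))
          = (1 + \<bar>real_of_int k\<bar>)\<^sup>2 / x powr (2 + real p * gam)"
        using x by (simp add: powr_add powr_minus power_mult_distrib power_inverse divide_inverse)
      finally show ?thesis .
    qed
    have "(\<integral>\<^sup>+ \<omega>. ennreal ((D n k \<omega> / w n k) ^ p) \<partial>M)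
        = (\<integral>\<^sup>+ \<omega>. ennreal (1 / w n k ^ p) * ennreal (D n k \<omega> ^ p) \<partial>M)"
      using w[of n k] D by (intro nn_integral_cong) (simp add: ennreal_mult[symmetric] power_divide)
    also have "\<dots> = ennreal (1 / w n k ^ p) * (\<integral>\<^sup>+ \<omega>. ennreal (D n k \<omega> ^ p) \<partial>M)"
      by (rule nn_integral_cmult) measurable
    also have "\<dots> \<le> ennreal (1 / w n k ^ p) * ennreal (c * (1 / x) powr (real p * H))"
    proof (intro mult_left_mono)
      have "\<bar>real_of_int (k + 1) / 2 ^ n - real_of_int k / 2 ^ n\<bar> = 1 / x"
        by (simp add: x_def diff_divide_distrib[symmetric])
      then show "(\<integral>\<^sup>+ \<omega>. ennreal (D n k \<omega> ^ p) \<partial>M) \<le> ennreal (c * (1 / x) powr (real p * H))"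
        unfolding D_def using moment[of "real_of_int (k + 1) / 2 ^ n" "real_of_int k / 2 ^ n"] by simp
    qed simp
    also have "\<dots> = ennreal (c * ((1 / x) powr (real p * H) / w n k ^ p))"
      using w[of n k] \<open>c \<ge> 0\<close> by (simp add: ennreal_mult[symmetric] mult.commute)
    also have "\<dots> \<le> ennreal (c * ((1 / 2) ^ n * (1 / (1 + \<bar>real_of_int k\<bar>)\<^sup>2)))"
    proof (intro ennreal_leI mult_left_mono \<open>c \<ge> 0\<close>)
      have "(1 / x) powr (real p * H) / w n k ^ p
          \<le> (1 / x) powr (real p * H) / ((1 + \<bar>real_of_int k\<bar>)\<^sup>2 / x powr (2 + real p * gam))"
        using wp x w[of n k] by (intro divide_left_mono) (auto intro!: mult_pos_pos divide_pos_pos zero_less_power add_pos_nonneg)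
      also have "\<dots> = x powr (2 - real p * (H - gam)) * (1 / (1 + \<bar>real_of_int k\<bar>)\<^sup>2)"
      proof -
        have "x powr (2 - real p * (H - gam)) = x powr (- (real p * H)) * x powr (2 + real p * gam)"
          by (simp add: powr_add[symmetric] algebra_simps)
        moreover have "(1 / x) powr (real p * H) = x powr (- (real p * H))"
          using x by (simp add: powr_minus powr_divide inverse_eq_divide)
        ultimately show ?thesis by simp
      qed
      also have "\<dots> \<le> x powr (- 1) * (1 / (1 + \<bar>real_of_int k\<bar>)\<^sup>2)"
        using x p by (intro mult_right_mono powr_mono) auto
      also have "x powr (- 1) = (1 / 2) ^ n"
        using x powr_neg_one[of x] unfolding x_def by (simp add: power_one_over)
      finally show "(1 / x) powr (real p * H) / w n k ^ p \<le> (1 / 2) ^ n * (1 / (1 + \<bar>real_of_int k\<bar>)\<^sup>2)" .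
    qed
    finally show ?thesis by (simp add: mult.assoc)
  qed
  have "(\<integral>\<^sup>+ \<omega>. S \<omega> \<partial>M) = (\<Sum>n. \<Sum>j. (\<integral>\<^sup>+ \<omega>. ennreal ((D n (int j) \<omega> / w n (int j)) ^ p) \<partial>M)
      + (\<integral>\<^sup>+ \<omega>. ennreal ((D n (- int j) \<omega> / w n (- int j)) ^ p) \<partial>M))"
    unfolding S_def by (simp add: nn_integral_suminf nn_integral_add)
  also have "\<dots> \<le> (\<Sum>n. \<Sum>j. ennreal (2 * c * (1 / 2) ^ n) * ennreal (1 / (1 + real j)\<^sup>2))"
  proof (intro suminf_le summableI)
    fix n j
    have "(\<integral>\<^sup>+ \<omega>. ennreal ((D n (int j) \<omega> / w n (int j)) ^ p) \<partial>M)
      + (\<integral>\<^sup>+ \<omega>. ennreal ((D n (- int j) \<omega> / w n (- int j)) ^ p) \<partial>M)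
      \<le> ennreal (c * (1 / 2) ^ n * (1 / (1 + real j)\<^sup>2)) + ennreal (c * (1 / 2) ^ n * (1 / (1 + real j)\<^sup>2))"
      using each[of n "int j"] each[of n "- int j"] by (intro add_mono) auto
    also have "\<dots> = ennreal (2 * c * (1 / 2) ^ n) * ennreal (1 / (1 + real j)\<^sup>2)"
      using \<open>c \<ge> 0\<close> by (simp add: ennreal_plus[symmetric] ennreal_mult[symmetric] del: ennreal_plus)
    finally show "(\<integral>\<^sup>+ \<omega>. ennreal ((D n (int j) \<omega> / w n (int j)) ^ p) \<partial>M)
      + (\<integral>\<^sup>+ \<omega>. ennreal ((D n (- int j) \<omega> / w n (- int j)) ^ p) \<partial>M)
      \<le> ennreal (2 * c * (1 / 2) ^ n) * ennreal (1 / (1 + real j)\<^sup>2)" .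
  qed
  also have "\<dots> = (\<Sum>n. ennreal (2 * c * (1 / 2) ^ n)) * (\<Sum>j. ennreal (1 / (1 + real j)\<^sup>2))"
    by (simp only: ennreal_suminf_cmult ennreal_suminf_multc)
  also have "\<dots> < \<infinity>"
  proof -
    have "summable (\<lambda>n. 2 * c * (1 / 2) ^ n)" by (intro summable_mult summable_geometric) simp
    then have "(\<Sum>n. ennreal (2 * c * (1 / 2) ^ n)) < \<infinity>"
      using \<open>c \<ge> 0\<close> by (subst suminf_ennreal2) auto
    moreover have "summable (\<lambda>j. 1 / (1 + real j)\<^sup>2)"
      using inverse_power_summable[of 2, where 'a=real] summable_Suc_iff[of "\<lambda>n. inverse (real n ^ 2)"]
      by (simp add: inverse_eq_divide)
    then have "(\<Sum>j. ennreal (1 / (1 + real j)\<^sup>2)) < \<infinity>"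
      by (subst suminf_ennreal2) auto
    ultimately show ?thesis by (simp add: ennreal_mult_less_top)
  qed
  finally have "AE \<omega> in M. S \<omega> \<noteq> \<infinity>"
    by (intro nn_integral_noteq_infinite) auto
  then have "AE \<omega> in M. \<forall>n k. D n k \<omega> \<le> (1 + enn2real (S \<omega>)) * w n k"
  proof eventually_elim
    case (elim \<omega>)
    have main: "D n k \<omega> \<le> (1 + enn2real (S \<omega>)) * w n k"
      if le: "ennreal ((D n k \<omega> / w n k) ^ p) \<le> S \<omega>" for n k
    proof -
      define y where "y = D n k \<omega> / w n k"
      have y: "y \<ge> 0" using D w[of n k] by (simp add: y_def)
      have "y ^ p \<le> enn2real (S \<omega>)"
        using enn2real_mono[OF le] elim y by (simp add: y_def top.not_eq_extremum)
      moreover have "y \<le> y ^ p" if "y \<ge> 1" using self_le_power[OF that p(1)] .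
      ultimately have "y \<le> 1 + enn2real (S \<omega>)"
        using enn2real_nonneg[of "S \<omega>"] by linarith
      then show ?thesis using w[of n k] by (simp add: y_def pos_divide_le_eq)
    qed
    show ?case
    proof (intro allI main)
      fix n k
      define a where "a j = ennreal ((D n (int j) \<omega> / w n (int j)) ^ p)
        + ennreal ((D n (- int j) \<omega> / w n (- int j)) ^ p)" for j
      have "ennreal ((D n k \<omega> / w n k) ^ p) \<le> a (nat \<bar>k\<bar>)"
        by (cases "k \<ge> 0") (simp_all add: a_def)
      also have "\<dots> \<le> (\<Sum>j. a j)" by (rule le_suminf_ennreal)
      also have "\<dots> \<le> S \<omega>"
        unfolding S_def a_def by (rule le_suminf_ennreal)
      finally show "ennreal ((D n k \<omega> / w n k) ^ p) \<le> S \<omega>" .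
    qed
  qed
  then show ?thesis
    by (intro that[of "\<lambda>\<omega>. 1 + enn2real (S \<omega>)"]) (auto simp: D_def w_def mult.assoc)
qed

section \<open>The stationary fractional Ornstein-Uhlenbeck process\<close>

text \<open>
  A single exponent \<open>\<beta>\<close> covers all \<open>T > 0\<close>. For \<open>T \<ge> 1\<close> the growth of the Hoelder constant gives
  \<open>T\<^sup>\<beta>\<close>, and \<open>\<bar>t - s\<bar>\<^sup>\<beta>\<close> is bounded by 1 or, for distant points, the bound on \<open>Y\<close> itself is used. For
  \<open>T < 1\<close> the Hoelder constant is bounded and the factor \<open>T\<^sup>\<beta>\<close> comes from \<open>\<bar>t - s\<bar>\<^sup>\<beta> \<le> T\<^sup>\<beta>\<close>.
\<close>

lemma hoelder_bound_on_all_horizons: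
  fixes Y :: "real \<Rightarrow> real"
  assumes "0 \<le> \<alpha>" "0 \<le> \<beta>" "\<beta> \<le> 1" "0 \<le> P" "0 \<le> Q"
    and bound: "\<And>t. \<bar>Y t\<bar> \<le> P * (3 + \<bar>t\<bar>) powr \<beta>"
    and hoelder: "\<And>s t. 0 \<le> s \<Longrightarrow> s \<le> t \<Longrightarrow> t - s \<le> 1 \<Longrightarrow>
      \<bar>Y t - Y s\<bar> \<le> Q * (3 + t) powr \<beta> * (t - s) powr (\<alpha> + \<beta>)"
    and "T > 0" "s \<in> {0..T}" "t \<in> {0..T}"
  shows "\<bar>Y t - Y s\<bar> \<le> 4 * (2 * P + Q) * T powr \<beta> * \<bar>t - s\<bar> powr \<alpha>"
proof -
  have large: "(3 + T) powr \<beta> \<le> 4 * T powr \<beta>" if "T \<ge> 1"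
  proof -
    have "(3 + T) powr \<beta> \<le> (4 * T) powr \<beta>" using that assms by (intro powr_mono2) auto
    also have "\<dots> = 4 powr \<beta> * T powr \<beta>" using that by (simp add: powr_mult)
    also have "\<dots> \<le> 4 powr 1 * T powr \<beta>" using assms by (intro mult_right_mono powr_mono) auto
    finally show ?thesis by simp
  qed
  have small: "(3 + T) powr \<beta> \<le> 4" if "T \<le> 1"
  proof -
    have "(3 + T) powr \<beta> \<le> 4 powr \<beta>" using that assms by (intro powr_mono2) auto
    also have "\<dots> \<le> 4 powr 1" using assms by (intro powr_mono) auto
    finally show ?thesis by simp
  qed
  have main: "\<bar>Y v - Y u\<bar> \<le> 4 * (2 * P + Q) * T powr \<beta> * (v - u) powr \<alpha>"
    if uv: "0 \<le> u" "u \<le> v" "v \<le> T" for u v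
  proof (cases "v - u \<le> 1")
    case True
    have w: "(3 + T) powr \<beta> * (v - u) powr \<beta> \<le> 4 * T powr \<beta>"
    proof (cases "T \<ge> 1")
      case True
      have "(v - u) powr \<beta> \<le> 1" using uv assms \<open>v - u \<le> 1\<close> by (intro powr_le1) auto
      then have "(3 + T) powr \<beta> * (v - u) powr \<beta> \<le> (3 + T) powr \<beta> * 1"
        by (intro mult_left_mono) auto
      then show ?thesis using large[OF True] by simp
    next
      case False
      then show ?thesis using uv assms small by (intro mult_mono powr_mono2) auto
    qed
    have "\<bar>Y v - Y u\<bar> \<le> Q * (3 + v) powr \<beta> * (v - u) powr (\<alpha> + \<beta>)"
      using uv True by (intro hoelder) auto
    also have "\<dots> \<le> Q * (3 + T) powr \<beta> * (v - u) powr (\<alpha> + \<beta>)"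
      using uv assms by (intro mult_right_mono mult_left_mono powr_mono2) auto
    also have "\<dots> = Q * ((3 + T) powr \<beta> * (v - u) powr \<beta>) * (v - u) powr \<alpha>"
      by (simp add: powr_add)
    also have "\<dots> \<le> Q * (4 * T powr \<beta>) * (v - u) powr \<alpha>"
      using w assms by (intro mult_right_mono mult_left_mono) auto
    also have "\<dots> \<le> 4 * (2 * P + Q) * T powr \<beta> * (v - u) powr \<alpha>"
      using assms by (intro mult_right_mono) (auto simp: algebra_simps)
    finally show ?thesis .
  next
    case False
    have "\<bar>Y x\<bar> \<le> P * (4 * T powr \<beta>)" if "0 \<le> x" "x \<le> T" for x
    proof -
      have "\<bar>Y x\<bar> \<le> P * (3 + x) powr \<beta>" using bound[of x] that by simp
      also have "\<dots> \<le> P * (3 + T) powr \<beta>"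
        using that assms by (intro mult_left_mono powr_mono2) auto
      also have "\<dots> \<le> P * (4 * T powr \<beta>)"
        using large False uv assms by (intro mult_left_mono) auto
      finally show ?thesis .
    qed
    from this[of u] this[of v] have "\<bar>Y v - Y u\<bar> \<le> 2 * (P * (4 * T powr \<beta>))"
      using uv by linarith
    also have "\<dots> \<le> 4 * (2 * P + Q) * T powr \<beta>"
      using assms by (simp add: algebra_simps)
    also have "\<dots> = 4 * (2 * P + Q) * T powr \<beta> * 1" by simp
    also have "\<dots> \<le> 4 * (2 * P + Q) * T powr \<beta> * (v - u) powr \<alpha>"
      using False assms by (intro mult_left_mono ge_one_powr_ge_zero) auto
    finally show ?thesis .
  qed
  show ?thesis
    using main[of s t] main[of t s] assms by (cases "s \<le> t") (auto simp: abs_minus_commute)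
qed

theorem proposition3p6:
  fixes M :: "'a measure" and B :: "real \<Rightarrow> 'a \<Rightarrow> real" and H lam \<sigma> :: real
  assumes "fractional_brownian_motion M H B"
    and "0 < H" and "H < 1 / 2"
    and "0 < lam"
  shows "\<forall>\<alpha>\<in>{0<..<H}. \<exists>\<beta> C. 0 < \<beta> \<and> \<beta> < 1 \<and> C \<in> borel_measurable M \<and>
    (AE \<omega> in M. \<forall>T>0. \<forall>s\<in>{0..T}. \<forall>t\<in>{0..T}.
       \<bar>fractional_OU lam \<sigma> B t \<omega> - fractional_OU lam \<sigma> B s \<omega>\<bar>
         \<le> C \<omega> * T powr \<beta> * \<bar>t - s\<bar> powr \<alpha>)"
proof
  fix \<alpha> assume "\<alpha> \<in> {0<..<H}"
  then have \<alpha>: "0 < \<alpha>" "\<alpha> < H" by auto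
  interpret fractional_brownian_motion M H B by fact
  define \<beta> where "\<beta> = (H - \<alpha>) / 2"
  define \<gamma> where "\<gamma> = \<alpha> + \<beta>"
  have \<beta>: "0 < \<beta>" "\<beta> < 1" using \<alpha> hurst by (auto simp: \<beta>_def)
  have \<gamma>: "0 < \<gamma>" "\<gamma> \<le> 1" and gap: "H - \<gamma> = \<beta>" using \<alpha> hurst by (auto simp: \<gamma>_def \<beta>_def field_simps)
  obtain m :: nat where m: "real m \<ge> 2 / \<beta>" using real_arch_simple by blast
  then have m': "2 \<le> real m * \<beta>" using \<beta> by (simp add: pos_divide_le_eq)
  then have "m > 0" by (cases "m = 0") auto
  have meas: "B t \<in> borel_measurable M" for t
    using gaussian[unfolded gaussian_process_def, rule_format, of "{t}" "\<lambda>_. 1"]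
    by (simp add: gaussian_rv_def)
  have order: "2 * m > 0" "2 \<le> real (2 * m) * \<beta>" "3 \<le> real (2 * m) * (H - \<gamma>)"
    using \<open>m > 0\<close> m' unfolding gap by simp_all
  obtain K where K: "K \<in> borel_measurable M" "\<And>\<omega>. K \<omega> \<ge> 0"
    and dyadic: "AE \<omega> in M. \<forall>n k. \<bar>B (real_of_int (k + 1) / 2 ^ n) \<omega> - B (real_of_int k / 2 ^ n) \<omega>\<bar>
        \<le> K \<omega> * (1 + \<bar>real_of_int k\<bar> / 2 ^ n) powr \<beta> * (2 powr (- \<gamma>)) ^ n"
    by (rule dyadic_increments_weighted_bound[OF meas increment_moment[OF \<open>m > 0\<close>] _ order]) (simp, rule that)
  define k where "k = 3 * (2 + 4 / lam)\<^sup>2"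
  define A where "A \<omega> = K \<omega> * chaining_const \<gamma>" for \<omega>
  define C where "C \<omega> = \<bar>\<sigma>\<bar> * (4 * (2 * (k * A \<omega>) + (1 + lam + k * lam) * A \<omega>))" for \<omega>
  have "C \<in> borel_measurable M"
    using K(1) unfolding C_def[abs_def] A_def by measurable
  moreover have "AE \<omega> in M. \<forall>T>0. \<forall>s\<in>{0..T}. \<forall>t\<in>{0..T}.
       \<bar>fractional_OU lam \<sigma> B t \<omega> - fractional_OU lam \<sigma> B s \<omega>\<bar>
         \<le> C \<omega> * T powr \<beta> * \<bar>t - s\<bar> powr \<alpha>"
    using dyadic continuous_paths
  proof eventually_elim
    case (elim \<omega>)
    interpret path: dyadic_hoelder "\<lambda>t. B t \<omega>" "K \<omega>" \<gamma> \<beta>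
      by (rule dyadic_hoelder.intro[OF elim(2) K(2) \<gamma>(1) less_imp_le[OF \<beta>(1)]
          less_imp_le[OF \<beta>(2)] elim(1)[rule_format]])
    define Y where "Y t = RS_integral_atMost (\<lambda>s. exp (- lam * (t - s))) (\<lambda>s. B s \<omega>) t" for t
    have A: "0 \<le> A \<omega>" using path.hoelder_const_nonneg by (simp add: A_def)
    note regularity = OU_integral_regularity[OF \<open>0 < lam\<close> elim(2) less_imp_le[OF \<beta>(1)]
        less_imp_le[OF \<beta>(2)] A less_imp_le[OF \<gamma>(1)] \<gamma>(2) path.growth[folded A_def]
        path.hoelder[folded A_def], folded k_def Y_def]
    have "\<bar>Y t - Y s\<bar> \<le> 4 * (2 * (k * A \<omega>) + (1 + lam + k * lam) * A \<omega>) * T powr \<beta> * \<bar>t - s\<bar> powr \<alpha>"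
      if "T > 0" "s \<in> {0..T}" "t \<in> {0..T}" for T s t
    proof (rule hoelder_bound_on_all_horizons[OF _ _ _ _ _ regularity(1) regularity(2)[unfolded \<gamma>_def] that])
      show "0 \<le> k * A \<omega>" "0 \<le> (1 + lam + k * lam) * A \<omega>"
        using A \<open>0 < lam\<close> by (simp_all add: k_def)
    qed (use \<alpha> \<beta> in auto)
    then have "\<bar>\<sigma>\<bar> * \<bar>Y t - Y s\<bar> \<le> \<bar>\<sigma>\<bar> * (4 * (2 * (k * A \<omega>) + (1 + lam + k * lam) * A \<omega>) * T powr \<beta> * \<bar>t - s\<bar> powr \<alpha>)"
      if "T > 0" "s \<in> {0..T}" "t \<in> {0..T}" for T s t
      using that by (intro mult_left_mono) auto
    moreover have "\<bar>fractional_OU lam \<sigma> B t \<omega> - fractional_OU lam \<sigma> B s \<omega>\<bar> = \<bar>\<sigma>\<bar> * \<bar>Y t - Y s\<bar>" for s t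
      by (simp add: fractional_OU_def Y_def abs_mult[symmetric] right_diff_distrib)
    ultimately show ?case by (simp add: C_def mult.assoc)
  qed
  ultimately show "\<exists>\<beta> C. 0 < \<beta> \<and> \<beta> < 1 \<and> C \<in> borel_measurable M \<and>
    (AE \<omega> in M. \<forall>T>0. \<forall>s\<in>{0..T}. \<forall>t\<in>{0..T}.
       \<bar>fractional_OU lam \<sigma> B t \<omega> - fractional_OU lam \<sigma> B s \<omega>\<bar>
         \<le> C \<omega> * T powr \<beta> * \<bar>t - s\<bar> powr \<alpha>)"
    using \<beta> by blast
qed

end
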